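(* Let $W\subseteq\mathbb{R}^n$ be closed and convex, let $f(w,z)$ be convex and $L$-smooth in $w\in W$ for each $z\in\mathcal{Z}$, and assume that the stochastic gradient $\nabla_w f(w,z)$ has $\sigma^2$-bounded variance for all $w\in W$. Suppose the update rule $\phi$ has the serial regret bound $\psi(\sigma^2,m)$ (in the sense of the context). Then the expected regret $\mathbb{E}[R(m)]$ of the distributed mini-batch (DMB) algorithm with batch size $b$ and latency parameter $\mu$, over a total of $m$ inputs, is at most $$(b+\mu)\,\psi\!\left(\frac{\sigma^2}{b},\left\lceil\frac{m}{b+\mu}\right\rceil\right).$$ Specifically, if $\psi(\sigma^2,m)=2D^2L+2D\sigma\sqrt{m}$ (that is, $\psi(v,m)=2D^2L+2D\sqrt{v}\,\sqrt{m}$ for all $v\ge 0$, with a constant $D\ge 0$), then setting the batch size $b=m^{1/3}$ gives the expected regret bound $$2D\sigma\sqrt{m}+2Dm^{1/3}\left(LD+\sigma\sqrt{\mu}\right)+2D\sigma m^{1/6}+2D\sigma\mu m^{-1/6}+2\mu D^2L .$$ In fact, for this $\psi$, if $b=m^{\rho}$ for any $\rho\in(0,1/2)$, the expected regret is bounded by $2D\sigma\sqrt{m}+o(\sqrt{m})$: for fixed $D,L,\sigma,\mu,k,\rho$ there is a function $r$ with $r(m)/\sqrt m\to0$ as $m\to\infty$ such that $\mathbb{E}[R(m)]\le 2D\sigma\sqrt m+r(m)$ for every $m$ for which $b=m^\rho$ is an admissible batch size.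
   Context: **Problem.** $z_1,z_2,\dots$ are i.i.d. samples from an unknown distribution on a sample space $\mathcal Z$. $\|\cdot\|$ is the Euclidean norm. $f:W\times\mathcal Z\to\mathbb R$ is the loss, $F(w)=\mathbb E_z[f(w,z)]$ (finite on $W$, with $\nabla F(w)=\mathbb E_z[\nabla_w f(w,z)]$), and $w^\star\in\arg\min_{w\in W}F(w)$ is assumed to exist. "$L$-smooth" means $\|\nabla_w f(w,z)-\nabla_w f(w',z)\|\le L\|w-w'\|$ for all $z\in\mathcal Z$ and $w,w'\in W$. "$v$-bounded variance" means $\mathbb E_z\|\nabla_w f(w,z)-\nabla F(w)\|^2\le v$ for all $w\in W$. **Update rule and serial algorithm.** An update rule is a deterministic map $\phi$ taking an auxiliary state $a_j$, a vector $g_j\in\mathbb R^n$ and a parameter $\alpha_j$, and returning $(w_{j+1},a_{j+1})=\phi(a_j,g_j,\alpha_j)$ with $w_{j+1}\in W$; the initial $w_1\in W$ and $a_1$ are fixed. The parameter sequence $(\alpha_j)$ may be chosen depending on the variance bound $v$; write it $(\alpha_j^{(v)})$. The serial algorithm, for $j=1,2,\dots$: predicts $w_j$, receives $z_j$, suffers loss $f(w_j,z_j)$, sets $g_j=\nabla_w f(w_j,z_j)$ and $(w_{j+1},a_{j+1})=\phi(a_j,g_j,\alpha_j)$. **Serial regret bound.** $\psi(v,m)$ is a function, nondecreasing in both arguments. "$\phi$ has the serial regret bound $\psi$" means: for every $v\ge0$ and every loss $f':W\times\mathcal Z'\to\mathbb R$ with i.i.d. inputs $z'_1,z'_2,\dots$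 on a sample space $\mathcal Z'$ such that $f'$ is convex and $L$-smooth in $w$, $\mathbb E_{z'}[f'(w,z')]=F(w)$ on $W$, and the gradients of $f'$ have $v$-bounded variance, the serial algorithm run on $f'$ with parameters $(\alpha^{(v)}_j)$ satisfies $\mathbb E\big[\sum_{j=1}^m (f'(w_j,z'_j)-f'(w^\star,z'_j))\big]\le\psi(v,m)$ for all $m\ge1$. **DMB algorithm.** There are $k\ge1$ nodes, a batch size $b$ (a positive integer), and a latency parameter $\mu$ (a nonnegative integer: the number of inputs processed by the whole system while one distributed vector-sum operation completes). It is assumed that $k$ divides $b$ and $\mu$ (admissible batch sizes are positive integers divisible by $k$; in the statements with $b=m^{1/3}$ or $b=m^\rho$, $m$ is such that this holds). The total input stream is processed in consecutive batches $j=1,2,\dots$, each consisting of $b+\mu$ consecutive inputs distributed evenly over the nodes. On every input of batch $j$ the system predicts with the same predictor $w_j$ and suffers the corresponding loss. The average gradient $\bar g_j=\frac1b\sum\nabla_w f(w_j,z)$ is taken over the first $b$ inputs $z$ of batch $j$ only (gradients on the last $\mu$ inputs are discarded), and then $(w_{j+1},a_{j+1})=\phi(a_j,\bar g_j,\alpha_j)$ with parameters $\alpha_j=\alpha_j^{(\sigma^2/b)}$. **Regret.** $R(m)=\sum_{i=1}^m\big(f(w_{j(i)},z_i)-f(w^\star,z_i)\big)$, where $j(i)=\lceil i/(b+\mu)\rceil$ is the batch containing input $i$; all inputs, including those whose gradients are discarded, are counted. *)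

theory Defs
  imports "HOL-Probability.Probability"
begin

(* All sequences are indexed from 0: input i is z i, and batch j uses the parameter \<alpha> j. *)

text \<open>
  Losses are only meaningful on \<open>W\<close>, so derivatives are taken within \<open>W\<close>. The gradient
  is carried as a separate function because it need not be unique when \<open>W\<close> has
  empty interior.
\<close>

definition has_gradient_on ::
  "(real^'n \<Rightarrow> real) \<Rightarrow> (real^'n \<Rightarrow> real^'n) \<Rightarrow> (real^'n) set \<Rightarrow> bool"
where
  "has_gradient_on h G W \<longleftrightarrow> (\<forall>w\<in>W. (h has_derivative (\<lambda>d. G w \<bullet> d)) (at w within W))"

definition smooth_on ::
  "real \<Rightarrow> (real^'n \<Rightarrow> real^'n) \<Rightarrow> (real^'n) set \<Rightarrow> bool"
where
  "smooth_on L G W \<longleftrightarrow> (\<forall>w\<in>W. \<forall>w'\<in>W. norm (G w - G w') \<le> L * norm (w - w'))"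

text \<open>Integrability is explicit because the Bochner integral of a non-integrable function is 0.\<close>

definition expectation_le :: "'b measure \<Rightarrow> ('b \<Rightarrow> real) \<Rightarrow> real \<Rightarrow> bool"
where
  "expectation_le P X c \<longleftrightarrow> integrable P X \<and> integral\<^sup>L P X \<le> c"

text \<open>
  A convex \<open>L\<close>-smooth loss \<open>f\<close> with gradient \<open>g\<close> on the probability space \<open>M\<close> whose mean is
  \<open>F\<close>, with mean gradient \<open>gF\<close> and gradient variance at most \<open>v\<close>. The sample space is
  \<open>space M\<close>.
\<close>

definition stochastic_loss ::
  "(real^'n) set \<Rightarrow> real \<Rightarrow> (real^'n \<Rightarrow> real) \<Rightarrow> (real^'n \<Rightarrow> real^'n) \<Rightarrow> real \<Rightarrow>
   's measure \<Rightarrow> (real^'n \<Rightarrow> 's \<Rightarrow> real) \<Rightarrow> (real^'n \<Rightarrow> 's \<Rightarrow> real^'n) \<Rightarrow> bool"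
where
  "stochastic_loss W L F gF v M f g \<longleftrightarrow>
     prob_space M \<and>
     (\<forall>z\<in>space M. convex_on W (\<lambda>w. f w z)
        \<and> has_gradient_on (\<lambda>w. f w z) (\<lambda>w. g w z) W
        \<and> smooth_on L (\<lambda>w. g w z) W) \<and>
     (\<forall>w\<in>W. integrable M (f w) \<and> integral\<^sup>L M (f w) = F w) \<and>
     (\<forall>w\<in>W. integrable M (g w) \<and> integral\<^sup>L M (g w) = gF w) \<and>
     (\<forall>w\<in>W. expectation_le M (\<lambda>z. (norm (g w z - gF w))\<^sup>2) v)"

text \<open>
  The measure \<open>A\<close> serves only as the measurable space of auxiliary states. Measurability of the
  rule is what makes the predictors random variables.
\<close>

definition update_rule ::
  "(real^'n) set \<Rightarrow> 'a measure \<Rightarrow> ('a \<Rightarrow> real^'n \<Rightarrow> 'p \<Rightarrow> (real^'n) \<times> 'a) \<Rightarrow> bool"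
where
  "update_rule W A \<phi> \<longleftrightarrow>
     (\<forall>p. (\<lambda>(a, x). \<phi> a x p) \<in> A \<Otimes>\<^sub>M borel \<rightarrow>\<^sub>M borel \<Otimes>\<^sub>M A) \<and>
     (\<forall>a\<in>space A. \<forall>x p. fst (\<phi> a x p) \<in> W)"

text \<open>\<open>G j w\<close> is the vector fed to the update rule in round \<open>j\<close> when the predictor is \<open>w\<close>.\<close>

primrec run ::
  "('a \<Rightarrow> real^'n \<Rightarrow> 'p \<Rightarrow> (real^'n) \<times> 'a) \<Rightarrow> (nat \<Rightarrow> 'p) \<Rightarrow> (real^'n) \<times> 'a \<Rightarrow>
   (nat \<Rightarrow> real^'n \<Rightarrow> real^'n) \<Rightarrow> nat \<Rightarrow> (real^'n) \<times> 'a"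
where
  "run \<phi> \<alpha> s G 0 = s"
| "run \<phi> \<alpha> s G (Suc j) = (let (w, a) = run \<phi> \<alpha> s G j in \<phi> a (G j w) (\<alpha> j))"

definition serial_predictor ::
  "('a \<Rightarrow> real^'n \<Rightarrow> 'p \<Rightarrow> (real^'n) \<times> 'a) \<Rightarrow> (nat \<Rightarrow> 'p) \<Rightarrow> (real^'n) \<times> 'a \<Rightarrow>
   (real^'n \<Rightarrow> 's \<Rightarrow> real^'n) \<Rightarrow> (nat \<Rightarrow> 's) \<Rightarrow> nat \<Rightarrow> real^'n"
where
  "serial_predictor \<phi> \<alpha> s g z j = fst (run \<phi> \<alpha> s (\<lambda>j w. g w (z j)) j)"

definition serial_regret ::
  "('a \<Rightarrow> real^'n \<Rightarrow> 'p \<Rightarrow> (real^'n) \<times> 'a) \<Rightarrow> (nat \<Rightarrow> 'p) \<Rightarrow> (real^'n) \<times> 'a \<Rightarrow>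
   (real^'n \<Rightarrow> 's \<Rightarrow> real) \<Rightarrow> (real^'n \<Rightarrow> 's \<Rightarrow> real^'n) \<Rightarrow> real^'n \<Rightarrow>
   nat \<Rightarrow> (nat \<Rightarrow> 's) \<Rightarrow> real"
where
  "serial_regret \<phi> \<alpha> s f g wstar m z =
     (\<Sum>j<m. f (serial_predictor \<phi> \<alpha> s g z j) (z j) - f wstar (z j))"

definition dmb_predictor ::
  "('a \<Rightarrow> real^'n \<Rightarrow> 'p \<Rightarrow> (real^'n) \<times> 'a) \<Rightarrow> (nat \<Rightarrow> 'p) \<Rightarrow> (real^'n) \<times> 'a \<Rightarrow>
   (real^'n \<Rightarrow> 's \<Rightarrow> real^'n) \<Rightarrow> nat \<Rightarrow> nat \<Rightarrow> (nat \<Rightarrow> 's) \<Rightarrow> nat \<Rightarrow> real^'n"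
where
  "dmb_predictor \<phi> \<alpha> s g b \<mu> z j =
     fst (run \<phi> \<alpha> s (\<lambda>j w. (1 / real b) *\<^sub>R (\<Sum>i<b. g w (z (j * (b + \<mu>) + i)))) j)"

definition dmb_regret ::
  "('a \<Rightarrow> real^'n \<Rightarrow> 'p \<Rightarrow> (real^'n) \<times> 'a) \<Rightarrow> (nat \<Rightarrow> 'p) \<Rightarrow> (real^'n) \<times> 'a \<Rightarrow>
   (real^'n \<Rightarrow> 's \<Rightarrow> real) \<Rightarrow> (real^'n \<Rightarrow> 's \<Rightarrow> real^'n) \<Rightarrow> real^'n \<Rightarrow>
   nat \<Rightarrow> nat \<Rightarrow> nat \<Rightarrow> (nat \<Rightarrow> 's) \<Rightarrow> real"
where
  "dmb_regret \<phi> \<alpha> s f g wstar b \<mu> m z =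
     (\<Sum>i<m. f (dmb_predictor \<phi> \<alpha> s g b \<mu> z (i div (b + \<mu>))) (z i) - f wstar (z i))"

text \<open>
  HOL cannot quantify over the type of the sample space inside a formula, so this type
  \<open>'s\<close> is a parameter; the sample spaces are all probability spaces on \<open>'s\<close>. Sample
  sequences are drawn from the infinite product measure.
\<close>

definition serial_regret_bound ::
  "'s itself \<Rightarrow> (real^'n) set \<Rightarrow> real \<Rightarrow> (real^'n \<Rightarrow> real) \<Rightarrow> (real^'n \<Rightarrow> real^'n) \<Rightarrow> real^'n \<Rightarrow>
   ('a \<Rightarrow> real^'n \<Rightarrow> 'p \<Rightarrow> (real^'n) \<times> 'a) \<Rightarrow> (real \<Rightarrow> nat \<Rightarrow> 'p) \<Rightarrow> (real^'n) \<times> 'a \<Rightarrow>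
   (real \<Rightarrow> nat \<Rightarrow> real) \<Rightarrow> bool"
where
  "serial_regret_bound TYPE('s) W L F gF wstar \<phi> \<alpha> s \<psi> \<longleftrightarrow>
     (\<forall>v\<ge>0. \<forall>(M' :: 's measure) f' g'. stochastic_loss W L F gF v M' f' g' \<longrightarrow>
        (\<forall>m\<ge>1. expectation_le (\<Pi>\<^sub>M i\<in>(UNIV :: nat set). M')
                  (serial_regret \<phi> (\<alpha> v) s f' g' wstar m) (\<psi> v m)))"

definition nondecreasing2 :: "(real \<Rightarrow> nat \<Rightarrow> real) \<Rightarrow> bool"
where
  "nondecreasing2 \<psi> \<longleftrightarrow>
     (\<forall>v v' m m'. 0 \<le> v \<and> v \<le> v' \<and> 1 \<le> m \<and> m \<le> m' \<longrightarrow> \<psi> v m \<le> \<psi> v' m')"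

text \<open>
  The serial bound is needed for losses averaged over mini-batches, whose samples are
  tuples of elements of \<open>'z\<close> and live in the type \<open>nat \<Rightarrow> 'z\<close>.
\<close>

definition dmb_setting ::
  "(real^'n) set \<Rightarrow> real \<Rightarrow> real \<Rightarrow> (real^'n \<Rightarrow> real) \<Rightarrow> (real^'n \<Rightarrow> real^'n) \<Rightarrow>
   'z measure \<Rightarrow> (real^'n \<Rightarrow> 'z \<Rightarrow> real) \<Rightarrow> (real^'n \<Rightarrow> 'z \<Rightarrow> real^'n) \<Rightarrow> real^'n \<Rightarrow>
   'a measure \<Rightarrow> ('a \<Rightarrow> real^'n \<Rightarrow> 'p \<Rightarrow> (real^'n) \<times> 'a) \<Rightarrow> (real \<Rightarrow> nat \<Rightarrow> 'p) \<Rightarrow>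
   real^'n \<Rightarrow> 'a \<Rightarrow> (real \<Rightarrow> nat \<Rightarrow> real) \<Rightarrow> bool"
where
  "dmb_setting W L \<sigma> F gF M f g wstar A \<phi> \<alpha> w1 a1 \<psi> \<longleftrightarrow>
     closed W \<and> convex W \<and> 0 \<le> \<sigma> \<and>
     stochastic_loss W L F gF (\<sigma>\<^sup>2) M f g \<and>
     has_gradient_on F gF W \<and>
     is_arg_min F (\<lambda>w. w \<in> W) wstar \<and>
     update_rule W A \<phi> \<and> w1 \<in> W \<and> a1 \<in> space A \<and>
     nondecreasing2 \<psi> \<and>
     serial_regret_bound TYPE(nat \<Rightarrow> 'z) W L F gF wstar \<phi> \<alpha> (w1, a1) \<psi>"

text \<open>
  The distribution of a batch over the \<open>k\<close> nodes influences neither the averaged gradient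
  nor the regret, so \<open>k\<close> enters only through these divisibility conditions.
\<close>

definition admissible_sizes :: "nat \<Rightarrow> nat \<Rightarrow> nat \<Rightarrow> bool"
where
  "admissible_sizes k b \<mu> \<longleftrightarrow> 1 \<le> k \<and> 1 \<le> b \<and> k dvd b \<and> k dvd \<mu>"

definition dmb_expected_regret_le ::
  "real \<Rightarrow> 'z measure \<Rightarrow> (real^'n \<Rightarrow> 'z \<Rightarrow> real) \<Rightarrow> (real^'n \<Rightarrow> 'z \<Rightarrow> real^'n) \<Rightarrow> real^'n \<Rightarrow>
   ('a \<Rightarrow> real^'n \<Rightarrow> 'p \<Rightarrow> (real^'n) \<times> 'a) \<Rightarrow> (real \<Rightarrow> nat \<Rightarrow> 'p) \<Rightarrow> real^'n \<Rightarrow> 'a \<Rightarrow>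
   nat \<Rightarrow> nat \<Rightarrow> nat \<Rightarrow> real \<Rightarrow> bool"
where
  "dmb_expected_regret_le \<sigma> M f g wstar \<phi> \<alpha> w1 a1 b \<mu> m c \<longleftrightarrow>
     expectation_le (\<Pi>\<^sub>M i\<in>(UNIV :: nat set). M)
       (dmb_regret \<phi> (\<alpha> (\<sigma>\<^sup>2 / real b)) (w1, a1) f g wstar b \<mu> m) c"

end

theory Submission
  imports Defs
begin

text \<open>
  A mini-batch \<open>x\<close> of \<open>b\<close> inputs is one sample of the averaged loss, which is again convex and
  \<open>L\<close>-smooth with mean \<open>F\<close> and has gradient variance at most \<open>\<sigma>\<^sup>2 / b\<close>, so the serial bound
  controls the serial algorithm run on averaged losses. The DMB algorithm with its latency gaps and
  this serial algorithm produce states \<open>(w\<^sub>j, a\<^sub>j)\<close> with the same law, and \<open>w\<^sub>j\<close> is independent of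
  batch \<open>j\<close> in both. Hence every input of batch \<open>j\<close>, used or discarded, contributes the same
  expected regret \<open>E (F w\<^sub>j - F wstar) \<ge> 0\<close> to the DMB regret as round \<open>j\<close> does to the serial regret,
  and each batch consists of at most \<open>b + \<mu>\<close> inputs. The numerical bounds follow from subadditivity
  of the square root.
\<close>

subsection \<open>Laws of the iterates\<close>

text \<open>Replacing \<open>w\<close> by a simple approximation \<open>s i w\<close> leaves
  finitely many measurable pieces, and continuity in \<open>w\<close> carries joint measurability to
  the pointwise limit.\<close>

lemma borel_measurable_caratheodory:
  fixes h :: "'w::{metric_space, second_countable_topology} \<Rightarrow> 's \<Rightarrow> 'b::{metric_space, second_countable_topology}"
  assumes h: "\<And>w. h w \<in> borel_measurable M"
    and cont: "\<And>z. z \<in> space M \<Longrightarrow> continuous_on UNIV (\<lambda>w. h w z)"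
  shows "(\<lambda>(w, z). h w z) \<in> borel_measurable (borel \<Otimes>\<^sub>M M)"
proof -
  \<comment> \<open>The identity is a pointwise limit of simple functions; \<open>undefined\<close>
    serves as an arbitrary base point of the approximation.\<close>
  obtain s :: "nat \<Rightarrow> 'w \<Rightarrow> 'w" where s: "\<And>i. simple_function borel (s i)"
    and lim: "\<And>w. (\<lambda>i. s i w) \<longlonglongrightarrow> w"
    using borel_measurable_implies_sequence_metric[of "\<lambda>w. w" borel undefined] by auto
  show ?thesis
  proof (rule borel_measurable_LIMSEQ_metric)
    fix i
    have fin: "finite (range (s i))"
      using simple_functionD(1)[OF s[of i]] by simp
    have "s i \<in> borel \<rightarrow>\<^sub>M count_space (range (s i))"
      using simple_functionD(2)[OF s[of i]] by (auto simp: measurable_count_space_eq2 fin)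
    from measurable_compose[OF measurable_fst this]
    have si: "(\<lambda>x. s i (fst x)) \<in> borel \<Otimes>\<^sub>M M \<rightarrow>\<^sub>M count_space (range (s i))" .
    show "(\<lambda>x. h (s i (fst x)) (snd x)) \<in> borel_measurable (borel \<Otimes>\<^sub>M M)"
      by (rule measurable_compose_countable'[OF _ si])
        (auto intro: countable_finite[OF fin] measurable_compose[OF measurable_snd h])
  next
    fix x :: "'w \<times> 's" assume "x \<in> space (borel \<Otimes>\<^sub>M M)"
    then have "snd x \<in> space M" by (auto simp: space_pair_measure)
    then show "(\<lambda>i. h (s i (fst x)) (snd x)) \<longlonglongrightarrow> (case x of (w, z) \<Rightarrow> h w z)"
      using continuous_on_tendsto_compose[OF cont, of "snd x" "\<lambda>i. s i (fst x)" "fst x" sequentially] lim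
      by (simp add: split_beta)
  qed
qed

lemma (in sequence_space) measurable_shift [measurable]:
  "(\<lambda>z i. z (n + i)) \<in> S \<rightarrow>\<^sub>M S"
  by (rule measurable_PiM_single') (auto simp: space_PiM PiE_iff)

text \<open>Splicing the first \<open>n\<close> entries of one stream with an independent second
  stream again gives a stream of law \<open>S\<close>. \<open>T\<close> sees only the first part and
  the shift returns exactly the second, so past and future separate into a product.\<close>

lemma (in sequence_space) distr_prefix_shift:
  assumes T [measurable]: "T \<in> S \<rightarrow>\<^sub>M N"
    and prefix: "\<And>x y. (\<And>i. i < n \<Longrightarrow> x i = y i) \<Longrightarrow> T x = T y"
  shows "distr S (N \<Otimes>\<^sub>M S) (\<lambda>z. (T z, \<lambda>i. z (n + i))) = distr S N T \<Otimes>\<^sub>M S"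
proof -
  have "distr S (N \<Otimes>\<^sub>M S) (\<lambda>z. (T z, \<lambda>i. z (n + i)))
      = distr (distr (S \<Otimes>\<^sub>M S) S (\<lambda>(x, y). comb_seq n x y)) (N \<Otimes>\<^sub>M S) (\<lambda>z. (T z, \<lambda>i. z (n + i)))"
    by (simp only: PiM_comb_seq)
  also have "\<dots> = distr (S \<Otimes>\<^sub>M S) (N \<Otimes>\<^sub>M S) (\<lambda>(x, y). (T x, y))"
  proof (subst distr_distr, simp_all, rule distr_cong, simp_all add: split_beta comp_def)
    fix x :: "(nat \<Rightarrow> 'a) \<times> (nat \<Rightarrow> 'a)"
    have "T (comb_seq n (fst x) (snd x)) = T (fst x)"
      by (rule prefix) (simp add: comb_seq_less)
    moreover have "(\<lambda>i. comb_seq n (fst x) (snd x) (n + i)) = snd x"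
      by (simp add: comb_seq_def)
    ultimately show "T (comb_seq n (fst x) (snd x)) = T (fst x) \<and>
        (\<lambda>i. comb_seq n (fst x) (snd x) (n + i)) = snd x" ..
  qed
  also have "\<dots> = distr S N T \<Otimes>\<^sub>M distr S S (\<lambda>y. y)"
    by (rule pair_measure_distr[symmetric]) (auto simp: distr_id2 sigma_finite_measure_axioms)
  finally show ?thesis by (simp add: distr_id2)
qed

text \<open>Only the distribution of the sample used in a round matters for the law of the next state, so
  runs on different streams can be compared through this recursion.\<close>

primrec state_law ::
  "'a measure \<Rightarrow> ('a \<Rightarrow> real^'n \<Rightarrow> 'p \<Rightarrow> (real^'n) \<times> 'a) \<Rightarrow> (nat \<Rightarrow> 'p) \<Rightarrow> (real^'n) \<times> 'a \<Rightarrow>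
   'x measure \<Rightarrow> (real^'n \<Rightarrow> 'x \<Rightarrow> real^'n) \<Rightarrow> nat \<Rightarrow> ((real^'n) \<times> 'a) measure"
where
  "state_law A \<phi> \<alpha> s Q h 0 = return (borel \<Otimes>\<^sub>M A) s"
| "state_law A \<phi> \<alpha> s Q h (Suc j) =
     distr (state_law A \<phi> \<alpha> s Q h j \<Otimes>\<^sub>M Q) (borel \<Otimes>\<^sub>M A) (\<lambda>((w, a), x). \<phi> a (h w x) (\<alpha> j))"

lemma sets_state_law [simp, measurable_cong]:
  "sets (state_law A \<phi> \<alpha> s Q h j) = sets (borel \<Otimes>\<^sub>M A)"
  by (cases j) auto

text \<open>\<open>Q\<close> is the law of the sample of a round, and \<open>K\<close> extracts that
  sample from the stream shifted to the start of the round. By \<open>prefix\<close>, an update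
  reads only its own block of \<open>B\<close> inputs, so the state before round \<open>j\<close> is
  a function of the first \<open>j * B\<close> inputs and is independent of the sample of round
  \<open>j\<close>. The sample \<open>K x\<close> itself may reach beyond the block; only its use in
  \<open>h\<close> is restricted.\<close>

lemma (in sequence_space)
  fixes \<phi> :: "'c \<Rightarrow> real^'n \<Rightarrow> 'p \<Rightarrow> (real^'n) \<times> 'c" and \<alpha> :: "nat \<Rightarrow> 'p"
  assumes \<phi> [measurable]: "\<And>p. (\<lambda>(a, x). \<phi> a x p) \<in> A \<Otimes>\<^sub>M borel \<rightarrow>\<^sub>M borel \<Otimes>\<^sub>M A"
    and s: "snd s \<in> space A"
    and h [measurable]: "(\<lambda>(w, x). h w x) \<in> borel \<Otimes>\<^sub>M Q \<rightarrow>\<^sub>M borel"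
    and K [measurable]: "K \<in> S \<rightarrow>\<^sub>M Q" and distr_K: "distr S Q K = Q"
    and prefix: "\<And>w x y. (\<And>i. i < B \<Longrightarrow> x i = y i) \<Longrightarrow> h w (K x) = h w (K y)"
  defines "T \<equiv> \<lambda>j z. run \<phi> \<alpha> s (\<lambda>j w. h w (K (\<lambda>i. z (j * B + i)))) j"
  shows measurable_run: "T j \<in> S \<rightarrow>\<^sub>M borel \<Otimes>\<^sub>M A"
    and distr_run: "distr S (borel \<Otimes>\<^sub>M A) (T j) = state_law A \<phi> \<alpha> s Q h j"
    and distr_run_sample: "distr S ((borel \<Otimes>\<^sub>M A) \<Otimes>\<^sub>M Q) (\<lambda>z. (T j z, K (\<lambda>i. z (j * B + i))))
      = state_law A \<phi> \<alpha> s Q h j \<Otimes>\<^sub>M Q"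
proof -
  \<comment> \<open>The next state is one fixed measurable map of the pair of state and sample, the
    same map as in \<open>state_law\<close>.\<close>
  have T_Suc: "T (Suc j) = (\<lambda>((w, a), x). \<phi> a (h w x) (\<alpha> j)) \<circ> (\<lambda>z. (T j z, K (\<lambda>i. z (j * B + i))))"
    for j by (simp add: T_def fun_eq_iff split_beta Let_def)
  have step [measurable]: "(\<lambda>((w, a), x). \<phi> a (h w x) (\<alpha> j)) \<in> (borel \<Otimes>\<^sub>M A) \<Otimes>\<^sub>M Q \<rightarrow>\<^sub>M borel \<Otimes>\<^sub>M A" for j
  proof -
    have "(\<lambda>y. (snd (fst y), h (fst (fst y)) (snd y))) \<in> (borel \<Otimes>\<^sub>M A) \<Otimes>\<^sub>M Q \<rightarrow>\<^sub>M A \<Otimes>\<^sub>M borel"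
      using h by measurable
    from measurable_compose[OF this \<phi>, of "\<alpha> j"] show ?thesis by (simp add: case_prod_beta')
  qed
  have meas: "T j \<in> S \<rightarrow>\<^sub>M borel \<Otimes>\<^sub>M A" for j
  proof (induction j)
    case 0
    show ?case using s by (auto simp: T_def space_pair_measure mem_Times_iff)
  next
    case (Suc j)
    note [measurable] = Suc
    show ?case unfolding T_Suc
      by (rule measurable_comp[OF _ step]) measurable
  qed
  note [measurable] = meas
  have pre: "T j x = T j y" if "\<And>i. i < j * B \<Longrightarrow> x i = y i" for j x y
    using that
  proof (induction j)
    case 0
    show ?case by (simp add: T_def)
  next
    case (Suc j)
    have "T j x = T j y" using Suc.prems by (intro Suc.IH) auto
    moreover have "h w (K (\<lambda>i. x (j * B + i))) = h w (K (\<lambda>i. y (j * B + i)))" for w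
      using Suc.prems by (intro prefix) auto
    ultimately show ?case by (simp add: T_Suc split_beta)
  qed
  have Q: "prob_space Q"
    using prob_space_distr[OF K] distr_K by simp
  have pair: "distr S ((borel \<Otimes>\<^sub>M A) \<Otimes>\<^sub>M Q) (\<lambda>z. (T j z, K (\<lambda>i. z (j * B + i))))
      = distr S (borel \<Otimes>\<^sub>M A) (T j) \<Otimes>\<^sub>M Q" for j
  proof -
    \<comment> \<open>An independent copy of the stream is fed to \<open>K\<close>;
      \<open>distr_prefix_shift\<close> then identifies state and fresh stream with state and actual
      tail.\<close>
    have "distr S (borel \<Otimes>\<^sub>M A) (T j) \<Otimes>\<^sub>M Q
       = distr (distr S (borel \<Otimes>\<^sub>M A) (T j)) (borel \<Otimes>\<^sub>M A) (\<lambda>y. y) \<Otimes>\<^sub>M distr S Q K"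
      by (simp add: distr_K distr_id2)
    also have "\<dots> = distr (distr S (borel \<Otimes>\<^sub>M A) (T j) \<Otimes>\<^sub>M S) ((borel \<Otimes>\<^sub>M A) \<Otimes>\<^sub>M Q) (\<lambda>(x, y). (x, K y))"
      by (rule pair_measure_distr) (auto simp: distr_K prob_space_imp_sigma_finite Q)
    also have "\<dots> = distr (distr S ((borel \<Otimes>\<^sub>M A) \<Otimes>\<^sub>M S) (\<lambda>z. (T j z, \<lambda>i. z (j * B + i))))
        ((borel \<Otimes>\<^sub>M A) \<Otimes>\<^sub>M Q) (\<lambda>(x, y). (x, K y))"
      by (subst distr_prefix_shift[OF meas pre]) auto
    also have "\<dots> = distr S ((borel \<Otimes>\<^sub>M A) \<Otimes>\<^sub>M Q) (\<lambda>z. (T j z, K (\<lambda>i. z (j * B + i))))"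
      by (subst distr_distr) (auto simp: comp_def)
    finally show ?thesis by simp
  qed
  have law: "distr S (borel \<Otimes>\<^sub>M A) (T j) = state_law A \<phi> \<alpha> s Q h j" for j
  proof (induction j)
    case 0
    have "s \<in> space (borel \<Otimes>\<^sub>M A)"
      using s by (simp add: space_pair_measure mem_Times_iff)
    then show ?case by (simp add: T_def distr_const)
  next
    case (Suc j)
    have "distr S (borel \<Otimes>\<^sub>M A) (T (Suc j))
      = distr (distr S ((borel \<Otimes>\<^sub>M A) \<Otimes>\<^sub>M Q) (\<lambda>z. (T j z, K (\<lambda>i. z (j * B + i)))))
          (borel \<Otimes>\<^sub>M A) (\<lambda>((w, a), x). \<phi> a (h w x) (\<alpha> j))"
      unfolding T_Suc by (rule distr_distr[symmetric]) auto
    then show ?case by (simp add: pair Suc)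
  qed
  show "T j \<in> S \<rightarrow>\<^sub>M borel \<Otimes>\<^sub>M A" by (rule meas)
  show "distr S (borel \<Otimes>\<^sub>M A) (T j) = state_law A \<phi> \<alpha> s Q h j" by (rule law)
  show "distr S ((borel \<Otimes>\<^sub>M A) \<Otimes>\<^sub>M Q) (\<lambda>z. (T j z, K (\<lambda>i. z (j * B + i))))
      = state_law A \<phi> \<alpha> s Q h j \<Otimes>\<^sub>M Q"
    by (simp add: pair law)
qed

subsection \<open>Averages over independent samples\<close>

lemma (in prob_space) distr_pair_snd:
  assumes "sigma_finite_measure N"
  shows "distr (M \<Otimes>\<^sub>M N) N snd = N"
proof (rule measure_eqI)
  interpret N: sigma_finite_measure N by fact
  fix X assume "X \<in> sets (distr (M \<Otimes>\<^sub>M N) N snd)"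
  then have X: "X \<in> sets N" by simp
  then have "snd -` X \<inter> space (M \<Otimes>\<^sub>M N) = space M \<times> X"
    using sets.sets_into_space[OF X] by (auto simp: space_pair_measure)
  then show "emeasure (distr (M \<Otimes>\<^sub>M N) N snd) X = emeasure N X"
    using X by (simp add: emeasure_distr N.emeasure_pair_measure_Times emeasure_space_1)
qed simp

lemma sum_case_nat:
  fixes u :: "'s \<Rightarrow> 'b::comm_monoid_add"
  shows "(\<Sum>i<Suc n. u (case_nat z x i)) = u z + (\<Sum>i<n. u (x i))"
  by (simp only: sum.lessThan_Suc_shift old.nat.case)

context sequence_space
begin

lemma distr_component: "distr S M (\<lambda>x. x i) = M"
  by (rule distr_PiM_component) (auto simp: prob_space)

lemma integrable_component:
  fixes u :: "'a \<Rightarrow> 'b::{banach, second_countable_topology}"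
  assumes "integrable M u"
  shows "integrable S (\<lambda>x. u (x i))"
  by (rule integrable_distr[of _ S M]) (auto simp: distr_component assms)

lemma integral_component:
  fixes u :: "'a \<Rightarrow> 'b::{banach, second_countable_topology}"
  assumes "u \<in> borel_measurable M"
  shows "(\<integral>x. u (x i) \<partial>S) = integral\<^sup>L M u"
  using integral_distr[of "\<lambda>x. x i" S M u] assms by (simp add: distr_component)

text \<open>Splitting off the first entry leaves an independent tail sum. This sum is centred, so
  the cross term integrates to 0 and second moments add.\<close>

lemma
  fixes u :: "'a \<Rightarrow> 'b::euclidean_space"
  assumes u: "integrable M u" and zero: "integral\<^sup>L M u = 0"
    and u2: "integrable M (\<lambda>z. (norm (u z))\<^sup>2)"
  shows integrable_second_moment_sum: "integrable S (\<lambda>x. (norm (\<Sum>i<n. u (x i)))\<^sup>2)"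
    and second_moment_sum:
      "(\<integral>x. (norm (\<Sum>i<n. u (x i)))\<^sup>2 \<partial>S) = real n * (\<integral>z. (norm (u z))\<^sup>2 \<partial>M)"
proof -
  have [measurable]: "u \<in> borel_measurable M" using u by auto
  interpret MS: pair_prob_space M S ..
  have dsnd: "distr (M \<Otimes>\<^sub>M S) S snd = S"
    by (rule M.distr_pair_snd) (rule P.sigma_finite_measure_axioms)
  have "integrable S (\<lambda>x. (norm (\<Sum>i<n. u (x i)))\<^sup>2) \<and>
      (\<integral>x. (norm (\<Sum>i<n. u (x i)))\<^sup>2 \<partial>S) = real n * (\<integral>z. (norm (u z))\<^sup>2 \<partial>M)"
  proof (induction n)
    case 0
    show ?case by simp
  next
    case (Suc n)
    \<comment> \<open>\<open>T\<close> is the DMB run and \<open>T'\<close> the serial run on the mini-batch losses; the serial samples are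
    whole sequences, of which only the first \<open>b\<close> entries are read.\<close>
  define T where "T x = (\<Sum>i<n. u (x i))" for x
    have T: "integrable S T" unfolding T_def
      by (intro Bochner_Integration.integrable_sum integrable_component u)
    have T0: "integral\<^sup>L S T = 0" unfolding T_def
      by (subst Bochner_Integration.integral_sum) (auto intro: integrable_component u simp: integral_component zero)
    have [measurable]: "T \<in> borel_measurable S" using T by auto
    from Suc have T2: "integrable S (\<lambda>x. (norm (T x))\<^sup>2)"
      and IH: "(\<integral>x. (norm (T x))\<^sup>2 \<partial>S) = real n * (\<integral>z. (norm (u z))\<^sup>2 \<partial>M)"
      by (simp_all add: T_def)
    have i1: "integrable (M \<Otimes>\<^sub>M S) (\<lambda>p. (norm (u (fst p)))\<^sup>2)"
      by (rule integrable_distr[of fst _ M]) (auto simp: P.distr_pair_fst u2)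
    have i2: "integrable (M \<Otimes>\<^sub>M S) (\<lambda>p. (norm (T (snd p)))\<^sup>2)"
      by (rule integrable_distr[of snd _ S]) (simp_all add: dsnd T2)
    \<comment> \<open>Cauchy-Schwarz and the arithmetic-geometric mean inequality dominate the cross
      term by the two squares, which makes Fubini applicable.\<close>
    have i3: "integrable (M \<Otimes>\<^sub>M S) (\<lambda>p. u (fst p) \<bullet> T (snd p))"
    proof (rule Bochner_Integration.integrable_bound[OF Bochner_Integration.integrable_add[OF i1 i2]])
      show "AE p in M \<Otimes>\<^sub>M S. norm (u (fst p) \<bullet> T (snd p))
          \<le> norm ((norm (u (fst p)))\<^sup>2 + (norm (T (snd p)))\<^sup>2)"
      proof (rule AE_I2)
        fix p :: "'a \<times> (nat \<Rightarrow> 'a)"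
        have "\<bar>u (fst p) \<bullet> T (snd p)\<bar> \<le> norm (u (fst p)) * norm (T (snd p))"
          by (rule Cauchy_Schwarz_ineq2)
        also have "\<dots> \<le> (norm (u (fst p)))\<^sup>2 + (norm (T (snd p)))\<^sup>2"
          using sum_squares_bound[of "norm (u (fst p))" "norm (T (snd p))"]
            mult_nonneg_nonneg[OF norm_ge_zero[of "u (fst p)"] norm_ge_zero[of "T (snd p)"]]
          by linarith
        finally show "norm (u (fst p) \<bullet> T (snd p))
          \<le> norm ((norm (u (fst p)))\<^sup>2 + (norm (T (snd p)))\<^sup>2)" by simp
      qed
    qed measurable
    have "(\<integral>p. u (fst p) \<bullet> T (snd p) \<partial>(M \<Otimes>\<^sub>M S)) = (\<integral>z. (\<integral>x. u z \<bullet> T x \<partial>S) \<partial>M)"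
      using MS.integral_fst'[OF i3] by simp
    then have v3: "(\<integral>p. u (fst p) \<bullet> T (snd p) \<partial>(M \<Otimes>\<^sub>M S)) = 0"
      by (simp add: T T0)
    have v1: "(\<integral>p. (norm (u (fst p)))\<^sup>2 \<partial>(M \<Otimes>\<^sub>M S)) = (\<integral>z. (norm (u z))\<^sup>2 \<partial>M)"
      using integral_distr[of fst "M \<Otimes>\<^sub>M S" M "\<lambda>z. (norm (u z))\<^sup>2"] by (simp add: P.distr_pair_fst)
    have v2: "(\<integral>p. (norm (T (snd p)))\<^sup>2 \<partial>(M \<Otimes>\<^sub>M S)) = (\<integral>x. (norm (T x))\<^sup>2 \<partial>S)"
      using integral_distr[of snd "M \<Otimes>\<^sub>M S" S "\<lambda>x. (norm (T x))\<^sup>2"]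
      by (simp add: dsnd)
    let ?N = "\<lambda>x. (norm (\<Sum>i<Suc n. u (x i)))\<^sup>2"
    let ?E = "\<lambda>p. ((norm (u (fst p)))\<^sup>2 + (norm (T (snd p)))\<^sup>2) + 2 * (u (fst p) \<bullet> T (snd p))"
    have N [measurable]: "?N \<in> borel_measurable S" by measurable
    have expand: "?N (case_nat (fst p) (snd p)) = ?E p" for p
      unfolding sum_case_nat T_def
      by (simp add: power2_norm_eq_inner inner_add_left inner_add_right inner_commute)
    have cn: "(\<lambda>(z, x). case_nat z x) \<in> M \<Otimes>\<^sub>M S \<rightarrow>\<^sub>M S" by measurable
    have "integrable (distr (M \<Otimes>\<^sub>M S) S (\<lambda>(z, x). case_nat z x)) ?N"
      using i1 i2 i3 by (simp only: integrable_distr_eq[OF cn N] split_beta expand) simp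
    moreover have "integral\<^sup>L (distr (M \<Otimes>\<^sub>M S) S (\<lambda>(z, x). case_nat z x)) ?N
       = real (Suc n) * (\<integral>z. (norm (u z))\<^sup>2 \<partial>M)"
      using i1 i2 i3 by (simp only: integral_distr[OF cn N] split_beta expand)
        (simp add: v1 v2 v3 IH algebra_simps)
    ultimately show ?case by (simp only: PiM_iter)
  qed
  then show "integrable S (\<lambda>x. (norm (\<Sum>i<n. u (x i)))\<^sup>2)"
    and "(\<integral>x. (norm (\<Sum>i<n. u (x i)))\<^sup>2 \<partial>S) = real n * (\<integral>z. (norm (u z))\<^sup>2 \<partial>M)"
    by auto
qed

text \<open>Integrating out all coordinates but the first leaves \<open>u\<close> plus the constant \<open>n * E u\<close>.\<close>

lemma integral_norm_le_sum:
  fixes u :: "'a \<Rightarrow> real"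
  assumes u: "integrable M u"
  shows "(\<integral>z. \<bar>u z\<bar> \<partial>M) \<le> (\<integral>x. \<bar>\<Sum>i<Suc n. u (x i)\<bar> \<partial>S) + real n * \<bar>integral\<^sup>L M u\<bar>"
proof -
  have [measurable]: "u \<in> borel_measurable M" using u by auto
  interpret MS: pair_prob_space M S ..
  let ?H = "\<lambda>x. \<bar>\<Sum>i<Suc n. u (x i)\<bar>"
  let ?G = "\<lambda>p. \<bar>u (fst p) + (\<Sum>i<n. u (snd p i))\<bar>"
  have H [measurable]: "?H \<in> borel_measurable S" by measurable
  have cn: "(\<lambda>(z, x). case_nat z x) \<in> M \<Otimes>\<^sub>M S \<rightarrow>\<^sub>M S" by measurable
  have "integrable S ?H"
    by (intro Bochner_Integration.integrable_abs Bochner_Integration.integrable_sum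
        integrable_component u)
  then have "integrable (distr (M \<Otimes>\<^sub>M S) S (\<lambda>(z, x). case_nat z x)) ?H"
    by (simp only: PiM_iter)
  then have G: "integrable (M \<Otimes>\<^sub>M S) ?G"
    by (simp only: integrable_distr_eq[OF cn H] split_beta sum_case_nat)
  have "integral\<^sup>L S ?H = integral\<^sup>L (distr (M \<Otimes>\<^sub>M S) S (\<lambda>(z, x). case_nat z x)) ?H"
    by (simp only: PiM_iter)
  also have "\<dots> = integral\<^sup>L (M \<Otimes>\<^sub>M S) ?G"
    by (simp only: integral_distr[OF cn H] split_beta sum_case_nat)
  also have "\<dots> = (\<integral>z. (\<integral>x. ?G (z, x) \<partial>S) \<partial>M)"
    using MS.integral_fst'[OF G] by simp
  finally have eq: "integral\<^sup>L S ?H = (\<integral>z. (\<integral>x. ?G (z, x) \<partial>S) \<partial>M)" .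
  have "\<bar>u z\<bar> \<le> (\<integral>x. ?G (z, x) \<partial>S) + real n * \<bar>integral\<^sup>L M u\<bar>" for z
  proof -
    have int: "integrable S (\<lambda>x. \<Sum>i<n. u (x i))"
      by (intro Bochner_Integration.integrable_sum integrable_component u)
    have "(\<integral>x. (\<Sum>i<n. u (x i)) \<partial>S) = real n * integral\<^sup>L M u"
      by (subst Bochner_Integration.integral_sum)
        (auto intro: integrable_component u simp: integral_component)
    then have "(\<integral>x. u z + (\<Sum>i<n. u (x i)) \<partial>S) = u z + real n * integral\<^sup>L M u"
      using int by (simp add: P.prob_space)
    \<comment> \<open>Jensen's inequality for the absolute value, over all coordinates but the
      first.\<close>
    moreover have "\<bar>\<integral>x. u z + (\<Sum>i<n. u (x i)) \<partial>S\<bar> \<le> (\<integral>x. ?G (z, x) \<partial>S)"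
      using integral_norm_bound[of S "\<lambda>x. u z + (\<Sum>i<n. u (x i))"] by simp
    moreover have "real n * \<bar>integral\<^sup>L M u\<bar> = \<bar>real n * integral\<^sup>L M u\<bar>"
      by (simp add: abs_mult)
    ultimately show ?thesis by linarith
  qed
  moreover have "integrable M (\<lambda>z. (\<integral>x. ?G (z, x) \<partial>S) + real n * \<bar>integral\<^sup>L M u\<bar>)"
    by (intro Bochner_Integration.integrable_add MS.integrable_fst'[OF G]) simp
  ultimately have "(\<integral>z. \<bar>u z\<bar> \<partial>M) \<le> (\<integral>z. (\<integral>x. ?G (z, x) \<partial>S) + real n * \<bar>integral\<^sup>L M u\<bar> \<partial>M)"
    by (intro integral_mono) (use u in auto)
  also have "\<dots> = integral\<^sup>L S ?H + real n * \<bar>integral\<^sup>L M u\<bar>"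
    unfolding eq using MS.integrable_fst'[OF G] by (subst Bochner_Integration.integral_add) (auto simp: M.prob_space)
  finally show ?thesis .
qed

text \<open>A serial regret bound yields integrability only for batch sums, whereas the distributed
  regret is a sum over single inputs. For fixed \<open>s\<close>,
  \<open>integral_norm_le_sum\<close> bounds the L1 norm of one summand by that of the sum plus
  \<open>n\<close> times the absolute mean, and both bounds are integrable in
  \<open>s\<close>.\<close>

lemma integrable_pair_of_sum:
  fixes f :: "'s \<Rightarrow> 'a \<Rightarrow> real"
  assumes N: "prob_space N" and f [measurable]: "(\<lambda>(s, z). f s z) \<in> borel_measurable (N \<Otimes>\<^sub>M M)"
    and int: "\<And>s. s \<in> space N \<Longrightarrow> integrable M (f s)"
    and sum: "integrable (N \<Otimes>\<^sub>M S) (\<lambda>(s, x). \<Sum>i<Suc n. f s (x i))"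
  shows "integrable (N \<Otimes>\<^sub>M M) (\<lambda>(s, z). f s z)"
proof -
  interpret N: prob_space N by fact
  interpret NM: pair_prob_space N M ..
  interpret NS: pair_prob_space N S ..
  let ?m = "\<lambda>s. integral\<^sup>L M (f s)"
  let ?a = "\<lambda>s. (\<integral>x. \<bar>\<Sum>i<Suc n. f s (x i)\<bar> \<partial>S)"
  have [measurable]: "?m \<in> borel_measurable N"
    using M.borel_measurable_lebesgue_integral[OF f] by simp
  have m: "(\<integral>x. (\<Sum>i<Suc n. f s (x i)) \<partial>S) = real (Suc n) * ?m s" if "s \<in> space N" for s
    by (subst Bochner_Integration.integral_sum)
      (auto intro: integrable_component int[OF that] simp: integral_component int[OF that]
        borel_measurable_integrable)
  \<comment> \<open>The inner integral of the sum is \<open>Suc n\<close> times the mean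
    \<open>?m s\<close>, so the mean is integrable as well.\<close>
  have "integrable N (\<lambda>s. \<integral>x. (\<Sum>i<Suc n. f s (x i)) \<partial>S)"
    using NS.integrable_fst'[OF sum] by (simp only: prod.case)
  then have "integrable N (\<lambda>s. real (Suc n) * ?m s)"
    by (subst (asm) Bochner_Integration.integrable_cong[OF refl m]) auto
  from integrable_mult_right[OF this, of "1 / real (Suc n)"]
  have im: "integrable N ?m" by (simp del: of_nat_Suc)
  have ia: "integrable N ?a"
    using NS.integrable_fst'[OF Bochner_Integration.integrable_abs[OF sum]] by (simp only: prod.case)
  show ?thesis
  proof (rule NM.Fubini_integrable)
    show "integrable N (\<lambda>s. \<integral>z. norm (case (s, z) of (s, z) \<Rightarrow> f s z) \<partial>M)"
    proof (rule Bochner_Integration.integrable_bound)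
      show "integrable N (\<lambda>s. ?a s + real n * \<bar>?m s\<bar>)" using ia im by auto
      show "AE s in N. norm (\<integral>z. norm (case (s, z) of (s, z) \<Rightarrow> f s z) \<partial>M)
          \<le> norm (?a s + real n * \<bar>?m s\<bar>)"
        using integral_norm_le_sum[OF int, of _ n]
        by (intro AE_I2) (fastforce intro: order_trans[OF _ abs_ge_self])
    qed measurable
    show "AE s in N. integrable M (\<lambda>z. case (s, z) of (s, z) \<Rightarrow> f s z)"
      by (intro AE_I2) (simp add: int)
  qed fact
qed

end

text \<open>A sample is a whole sequence of which \<open>b\<close> entries are read. The averaged
  loss thus lives on the infinite product measure, over the type for which the serial bound is
  assumed.\<close>

definition batch_mean :: "nat \<Rightarrow> ('w \<Rightarrow> 's \<Rightarrow> 'b::real_vector) \<Rightarrow> 'w \<Rightarrow> (nat \<Rightarrow> 's) \<Rightarrow> 'b" where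
  "batch_mean b h w x = (1 / real b) *\<^sub>R (\<Sum>i<b. h w (x i))"

lemma (in sequence_space) integrable_batch_mean:
  fixes h :: "'w \<Rightarrow> 'a \<Rightarrow> 'b::{banach, second_countable_topology}"
  assumes "integrable M (h w)"
  shows "integrable S (batch_mean b h w)"
  unfolding batch_mean_def
  by (intro integrable_scaleR_right Bochner_Integration.integrable_sum integrable_component assms)

lemma (in sequence_space) integral_batch_mean:
  fixes h :: "'w \<Rightarrow> 'a \<Rightarrow> 'b::{banach, second_countable_topology}"
  assumes h: "integrable M (h w)" and b: "b \<ge> 1"
  shows "integral\<^sup>L S (batch_mean b h w) = integral\<^sup>L M (h w)"
  unfolding batch_mean_def using b
  by (subst integral_scaleR_right, subst Bochner_Integration.integral_sum)
    (auto intro: integrable_component h simp: integral_component borel_measurable_integrable[OF h]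
      sum_constant_scaleR)

text \<open>Convexity, smoothness and means pass through averaging. The sum of \<open>b\<close>
  independent centred gradients has \<open>b\<close> times the single second moment, and the factor
  \<open>1 / b\<close> enters squared, which leaves \<open>v / b\<close>.\<close>

lemma stochastic_loss_batch_mean:
  assumes loss: "stochastic_loss W L F gF v M f g" and b: "b \<ge> 1"
  shows "stochastic_loss W L F gF (v / real b) (\<Pi>\<^sub>M i\<in>(UNIV::nat set). M)
    (batch_mean b f) (batch_mean b g)"
proof -
  note l = loss[unfolded stochastic_loss_def]
  interpret M: prob_space M using l by auto
  interpret sequence_space M
    unfolding sequence_space_def by (rule product_prob_spaceI) (rule M.prob_space_axioms)
  have "convex_on W (\<lambda>w. batch_mean b f w x)
       \<and> has_gradient_on (\<lambda>w. batch_mean b f w x) (\<lambda>w. batch_mean b g w x) W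
       \<and> smooth_on L (\<lambda>w. batch_mean b g w x) W" if "x \<in> space S" for x
  proof (intro conjI)
    have xi: "x i \<in> space M" for i
      using that by (auto simp: space_PiM)
    have cv: "convex_on W (\<lambda>w. f w (x i))" for i
      using l xi[of i] by auto
    \<comment> \<open>Convexity of \<open>W\<close> makes the empty sum, a constant, convex in the
      base case below.\<close>
    have W: "convex W" using cv convex_on_imp_convex by blast
    have "convex_on W (\<lambda>w. \<Sum>i<n. f w (x i))" for n
      by (induction n) (auto intro: convex_on_add cv simp: convex_on_const W)
    then show "convex_on W (\<lambda>w. batch_mean b f w x)"
      unfolding batch_mean_def real_scaleR_def by (intro convex_on_cmul) auto
    show "has_gradient_on (\<lambda>w. batch_mean b f w x) (\<lambda>w. batch_mean b g w x) W"
      unfolding has_gradient_on_def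
    proof
      fix w assume "w \<in> W"
      then have "((\<lambda>w. f w (x i)) has_derivative (\<lambda>d. g w (x i) \<bullet> d)) (at w within W)" for i
        using l xi[of i] by (auto simp: has_gradient_on_def)
      then have "((\<lambda>w. (1 / real b) *\<^sub>R (\<Sum>i<b. f w (x i))) has_derivative
          (\<lambda>d. (1 / real b) *\<^sub>R (\<Sum>i<b. g w (x i) \<bullet> d))) (at w within W)"
        by (intro has_derivative_scaleR_right has_derivative_sum)
      then show "((\<lambda>w. batch_mean b f w x) has_derivative (\<lambda>d. batch_mean b g w x \<bullet> d)) (at w within W)"
        by (simp add: batch_mean_def inner_sum_left)
    qed
    show "smooth_on L (\<lambda>w. batch_mean b g w x) W"
      unfolding smooth_on_def
    proof (intro ballI)
      fix w w' assume "w \<in> W" "w' \<in> W"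
      then have le: "norm (g w (x i) - g w' (x i)) \<le> L * norm (w - w')" for i
        using l xi[of i] by (auto simp: smooth_on_def)
      have "norm (batch_mean b g w x - batch_mean b g w' x)
          = (1 / real b) * norm (\<Sum>i<b. g w (x i) - g w' (x i))"
        by (simp add: batch_mean_def sum_subtractf flip: scaleR_diff_right)
      also have "\<dots> \<le> (1 / real b) * (\<Sum>i<b. L * norm (w - w'))"
        by (intro mult_left_mono sum_norm_le le) auto
      also have "\<dots> = L * norm (w - w')" using b by simp
      finally show "norm (batch_mean b g w x - batch_mean b g w' x) \<le> L * norm (w - w')" .
    qed
  qed
  moreover have "expectation_le S (\<lambda>x. (norm (batch_mean b g w x - gF w))\<^sup>2) (v / real b)"
    if w: "w \<in> W" for w
  proof -
    have g: "integrable M (g w)" "integral\<^sup>L M (g w) = gF w"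
      and g2: "integrable M (\<lambda>z. (norm (g w z - gF w))\<^sup>2)"
      and v: "(\<integral>z. (norm (g w z - gF w))\<^sup>2 \<partial>M) \<le> v"
      using l w by (auto simp: expectation_le_def)
    have u: "integrable M (\<lambda>z. g w z - gF w)" "(\<integral>z. g w z - gF w \<partial>M) = 0"
      using g by (auto simp: M.prob_space)
    have eq: "(norm (batch_mean b g w x - gF w))\<^sup>2
        = (1 / (real b)\<^sup>2) * (norm (\<Sum>i<b. g w (x i) - gF w))\<^sup>2" for x
    proof -
      have "batch_mean b g w x - gF w = (1 / real b) *\<^sub>R (\<Sum>i<b. g w (x i) - gF w)"
        using b by (simp add: batch_mean_def sum_subtractf sum_constant_scaleR scaleR_diff_right del: sum_constant)
      then show ?thesis by (simp only: norm_scaleR power_mult_distrib) (simp add: power_divide)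
    qed
    have "(\<integral>x. (norm (batch_mean b g w x - gF w))\<^sup>2 \<partial>S)
      = (1 / (real b)\<^sup>2) * (real b * (\<integral>z. (norm (g w z - gF w))\<^sup>2 \<partial>M))"
      unfolding eq by (simp add: second_moment_sum[OF u g2])
    also have "\<dots> \<le> v / real b"
      using b v by (simp add: power2_eq_square divide_right_mono)
    finally show ?thesis
      unfolding expectation_le_def eq
      using integrable_second_moment_sum[OF u g2, of b] by auto
  qed
  ultimately show ?thesis
    unfolding stochastic_loss_def
    using l b P.prob_space_axioms by (auto simp: integral_batch_mean integrable_batch_mean)
qed

subsection \<open>The distributed algorithm\<close>

text \<open>Each coordinate of the stream has law \<open>M\<close> and is independent of the first
  component, so every position of a batch contributes the same integral.\<close>

lemma (in sequence_space)
  fixes f :: "'s \<times> 'a \<Rightarrow> real"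
  assumes N: "prob_space N" and f: "integrable (N \<Otimes>\<^sub>M M) f"
  shows integrable_pair_component: "integrable (N \<Otimes>\<^sub>M S) (\<lambda>p. f (fst p, snd p i))"
    and integral_pair_component: "(\<integral>p. f (fst p, snd p i) \<partial>(N \<Otimes>\<^sub>M S)) = integral\<^sup>L (N \<Otimes>\<^sub>M M) f"
proof -
  have m: "(\<lambda>p. (fst p, snd p i)) \<in> N \<Otimes>\<^sub>M S \<rightarrow>\<^sub>M N \<Otimes>\<^sub>M M" by measurable
  have "distr N N (\<lambda>s. s) \<Otimes>\<^sub>M distr S M (\<lambda>x. x i)
      = distr (N \<Otimes>\<^sub>M S) (N \<Otimes>\<^sub>M M) (\<lambda>(s, x). (s, x i))"
    by (rule pair_measure_distr) (auto simp: distr_component M.sigma_finite_measure_axioms)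
  then have d: "distr (N \<Otimes>\<^sub>M S) (N \<Otimes>\<^sub>M M) (\<lambda>p. (fst p, snd p i)) = N \<Otimes>\<^sub>M M"
    by (simp add: distr_id2 distr_component case_prod_beta')
  show "integrable (N \<Otimes>\<^sub>M S) (\<lambda>p. f (fst p, snd p i))"
    by (rule integrable_distr[OF m]) (simp only: d f)
  show "(\<integral>p. f (fst p, snd p i) \<partial>(N \<Otimes>\<^sub>M S)) = integral\<^sup>L (N \<Otimes>\<^sub>M M) f"
    using integral_distr[OF m, of f] f by (simp add: d borel_measurable_integrable)
qed

section \<open>Runs inside \<open>W\<close> and summation over batches\<close>

lemma update_ruleD:
  assumes "update_rule W A \<phi>" "a \<in> space A"
  shows "fst (\<phi> a x p) \<in> W" "snd (\<phi> a x p) \<in> space A"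
proof -
  show "fst (\<phi> a x p) \<in> W" using assms by (auto simp: update_rule_def)
  have "(\<lambda>(a, x). \<phi> a x p) \<in> A \<Otimes>\<^sub>M borel \<rightarrow>\<^sub>M borel \<Otimes>\<^sub>M A"
    using assms by (auto simp: update_rule_def)
  from measurable_space[OF this, of "(a, x)"] show "snd (\<phi> a x p) \<in> space A"
    using assms by (auto simp: space_pair_measure)
qed

lemma run_in:
  assumes "update_rule W A \<phi>" "fst s \<in> W" "snd s \<in> space A"
  shows "fst (run \<phi> \<alpha> s G j) \<in> W \<and> snd (run \<phi> \<alpha> s G j) \<in> space A"
  using assms by (induction j) (auto simp: split_beta Let_def update_ruleD)

text \<open>Predictors never leave \<open>W\<close>, so gradients off \<open>W\<close> are never
  consulted. This permits replacing \<open>g\<close> by its composition with the projection onto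
  \<open>W\<close>.\<close>

lemma run_cong:
  assumes "update_rule W A \<phi>" "fst s \<in> W" "snd s \<in> space A"
    and eq: "\<And>j w. w \<in> W \<Longrightarrow> G j w = G' j w"
  shows "run \<phi> \<alpha> s G j = run \<phi> \<alpha> s G' j"
proof (induction j)
  case (Suc j)
  show ?case using run_in[OF assms(1-3), of \<alpha> G' j] by (simp add: Suc split_beta Let_def eq)
qed simp

lemma smooth_on_imp_continuous_on:
  assumes "smooth_on L G W"
  shows "continuous_on W G"
proof (rule lipschitz_on_continuous_on)
  \<comment> \<open>A Lipschitz constant must be nonnegative, while the sign of \<open>L\<close> is
    unknown here.\<close>
  show "\<bar>L\<bar>-lipschitz_on W G"
  proof (rule lipschitz_onI)
    fix x y assume "x \<in> W" "y \<in> W"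
    then have "norm (G x - G y) \<le> L * norm (x - y)"
      using assms by (auto simp: smooth_on_def)
    also have "\<dots> \<le> \<bar>L\<bar> * norm (x - y)" by (intro mult_right_mono) auto
    finally show "dist (G x) (G y) \<le> \<bar>L\<bar> * dist x y" by (simp add: dist_norm)
  qed simp
qed

text \<open>The last batch may be incomplete; nonnegativity allows filling it up, after which each
  of the \<open>n\<close> batches contributes \<open>B\<close> equal terms.\<close>

lemma sum_div_le:
  fixes r :: "nat \<Rightarrow> real"
  assumes "\<And>j. 0 \<le> r j" "m \<le> n * B"
  shows "(\<Sum>i<m. r (i div B)) \<le> real B * (\<Sum>j<n. r j)"
proof -
  have "(\<Sum>i<m. r (i div B)) \<le> (\<Sum>i<n * B. r (i div B))"
    using assms by (intro sum_mono2) auto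
  also have "\<dots> = (\<Sum>j<n. \<Sum>i=j*B..<j*B+B. r (i div B))"
    by (rule sum.nat_group[symmetric])
  also have "\<dots> = (\<Sum>j<n. \<Sum>i=j*B..<j*B+B. r j)"
  proof (intro sum.cong refl)
    fix j i assume "i \<in> {j * B..<j * B + B}"
    then have "i div B = j"
      by (intro div_nat_eqI) (auto simp: mult.commute)
    then show "r (i div B) = r j" by simp
  qed
  also have "\<dots> = real B * (\<Sum>j<n. r j)" by (simp add: sum_distrib_left)
  finally show ?thesis .
qed

section \<open>Comparison of the distributed with the serial regret\<close>

lemma dmb_expected_regret_bound:
  fixes W :: "(real^'n) set" and M :: "'z measure"
  assumes setting: "dmb_setting W L \<sigma> F gF M f g wstar A \<phi> \<alpha> w1 a1 \<psi>"
    and b: "1 \<le> b" and m: "1 \<le> m"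
  shows "dmb_expected_regret_le \<sigma> M f g wstar \<phi> \<alpha> w1 a1 b \<mu> m
    (real (b + \<mu>) * \<psi> (\<sigma>\<^sup>2 / real b) (nat \<lceil>real m / real (b + \<mu>)\<rceil>))"
proof -
  note set = setting[unfolded dmb_setting_def]
  have W: "closed W" "convex W" "W \<noteq> {}" and rule: "update_rule W A \<phi>"
    and init: "fst (w1, a1) \<in> W" "snd (w1, a1) \<in> space A"
    and loss: "stochastic_loss W L F gF (\<sigma>\<^sup>2) M f g"
    and arg_min: "is_arg_min F (\<lambda>w. w \<in> W) wstar"
    and serial: "serial_regret_bound TYPE(nat \<Rightarrow> 'z) W L F gF wstar \<phi> \<alpha> (w1, a1) \<psi>"
    using set by auto
  have wstar: "wstar \<in> W" and F_ge: "\<And>w. w \<in> W \<Longrightarrow> F wstar \<le> F w"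
    using arg_min by (auto simp: is_arg_min_def not_less)
  have \<phi>: "(\<lambda>(a, x). \<phi> a x p) \<in> A \<Otimes>\<^sub>M borel \<rightarrow>\<^sub>M borel \<Otimes>\<^sub>M A" for p
    using rule by (auto simp: update_rule_def)
  interpret M: prob_space M using loss by (auto simp: stochastic_loss_def)
  interpret sequence_space M
    unfolding sequence_space_def by (rule product_prob_spaceI) (rule M.prob_space_axioms)
  \<comment> \<open>The serial algorithm runs on mini-batches, so its stream is a sequence of
    sequences, with law \<open>S.S\<close>.\<close>
  interpret S: sequence_space S
    unfolding sequence_space_def by (rule product_prob_spaceI) (rule P.prob_space_axioms)

  define B where "B = b + \<mu>"
  define v where "v = \<sigma>\<^sup>2 / real b"
  \<comment> \<open>\<open>f\<close> and \<open>g\<close> are unconstrained off \<open>W\<close>; composing them with the projection makes them jointly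
    measurable everywhere and changes nothing along a run.\<close>
  define c where "c = closest_point W"
  have c_in: "c w \<in> W" for w using W by (simp add: c_def closest_point_in_set)
  have c_eq: "c w = w" if "w \<in> W" for w using that by (simp add: c_def closest_point_self)
  have c_cont: "continuous_on UNIV c" unfolding c_def using W by (intro continuous_on_closest_point)

  have fW: "integrable M (f w)" "integral\<^sup>L M (f w) = F w" if "w \<in> W" for w
    using loss that by (auto simp: stochastic_loss_def)
  have f_cont: "continuous_on W (\<lambda>w. f w z)" if "z \<in> space M" for z
    using loss that by (auto simp: stochastic_loss_def has_gradient_on_def
        intro!: has_derivative_continuous_on)
  have g_cont: "continuous_on W (\<lambda>w. g w z)" if "z \<in> space M" for z
    using loss that by (auto simp: stochastic_loss_def intro: smooth_on_imp_continuous_on)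
  have [measurable]: "(\<lambda>(w, z). f (c w) z) \<in> borel_measurable (borel \<Otimes>\<^sub>M M)"
    by (rule borel_measurable_caratheodory)
      (auto intro!: borel_measurable_integrable fW c_in
        continuous_on_compose2[OF f_cont c_cont])
  have g_meas [measurable]: "(\<lambda>(w, z). g (c w) z) \<in> borel_measurable (borel \<Otimes>\<^sub>M M)"
    using loss by (intro borel_measurable_caratheodory)
      (auto intro!: borel_measurable_integrable c_in continuous_on_compose2[OF g_cont c_cont]
        simp: stochastic_loss_def)
  have [measurable]: "f wstar \<in> borel_measurable M" using fW(1)[OF wstar] by simp

  define h where "h w = batch_mean b g (c w)" for w
  have h [measurable]: "(\<lambda>(w, x). h w x) \<in> borel \<Otimes>\<^sub>M S \<rightarrow>\<^sub>M borel"
    unfolding h_def batch_mean_def by measurable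
  define \<nu> where "\<nu> = state_law A \<phi> (\<alpha> v) (w1, a1) S h"
  have [measurable_cong]: "sets (\<nu> j) = sets (borel \<Otimes>\<^sub>M A)" for j by (simp add: \<nu>_def)

  \<comment> \<open>\<open>T\<close> is the DMB run and \<open>T'\<close> the serial run on the mini-batch losses; the serial samples are
    whole sequences, of which only the first \<open>b\<close> entries are read.\<close>
  define T where "T j z = run \<phi> (\<alpha> v) (w1, a1) (\<lambda>j w. h w (\<lambda>i. z (j * B + i))) j" for j z
  define T' where "T' j z = run \<phi> (\<alpha> v) (w1, a1) (\<lambda>j w. h w (z (j * 1 + 0))) j" for j z
  have h_prefix: "h w x = h w y" if "\<And>i. i < B \<Longrightarrow> x i = y i" for w x y
    unfolding h_def batch_mean_def using that by (simp add: B_def)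
  \<comment> \<open>With \<open>K\<close> the identity, the sample of a round is the entire
    remaining stream. The joint law therefore also covers the inputs of the batch whose gradients
    are discarded.\<close>
  have T [measurable]: "T j \<in> S \<rightarrow>\<^sub>M borel \<Otimes>\<^sub>M A"
    and T_law: "distr S (borel \<Otimes>\<^sub>M A) (T j) = \<nu> j"
    and T_sample: "distr S ((borel \<Otimes>\<^sub>M A) \<Otimes>\<^sub>M S) (\<lambda>z. (T j z, \<lambda>i. z (j * B + i))) = \<nu> j \<Otimes>\<^sub>M S" for j
    unfolding T_def[abs_def] \<nu>_def
    using measurable_run[OF \<phi> init(2) h _ _ h_prefix, where K="\<lambda>x. x" and \<alpha>="\<alpha> v" and j=j]
      distr_run[OF \<phi> init(2) h _ _ h_prefix, where K="\<lambda>x. x" and \<alpha>="\<alpha> v" and j=j]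
      distr_run_sample[OF \<phi> init(2) h _ _ h_prefix, where K="\<lambda>x. x" and \<alpha>="\<alpha> v" and j=j]
    by (simp_all add: distr_id2)
  \<comment> \<open>Here blocks have length 1 and \<open>K\<close> reads entry 0, which explains the
    index \<open>j * 1 + 0\<close> in \<open>T'\<close>.\<close>
  have T' [measurable]: "T' j \<in> S.S \<rightarrow>\<^sub>M borel \<Otimes>\<^sub>M A"
    and T'_sample: "distr S.S ((borel \<Otimes>\<^sub>M A) \<Otimes>\<^sub>M S) (\<lambda>z. (T' j z, z j)) = \<nu> j \<Otimes>\<^sub>M S" for j
    unfolding T'_def[abs_def] \<nu>_def
    using S.measurable_run[OF \<phi> init(2) h, where K="\<lambda>x. x 0" and B=1 and \<alpha>="\<alpha> v" and j=j]
      S.distr_run_sample[OF \<phi> init(2) h, where K="\<lambda>x. x 0" and B=1 and \<alpha>="\<alpha> v" and j=j]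
    by (simp_all add: S.distr_component)
  have \<nu>_prob: "prob_space (\<nu> j)" for j
    using P.prob_space_distr[OF T, of j] by (simp add: T_law)
  have T_in: "fst (T j z) \<in> W" and T'_in: "fst (T' j z') \<in> W" for j z z'
    unfolding T_def T'_def using run_in[OF rule init] by blast+

  \<comment> \<open>\<open>D\<close> is the regret of one input as a function of state and input;
    its mini-batch average \<open>D'\<close> is the regret of one serial round.\<close>
  define D where "D p = f (c (fst (fst p))) (snd p) - f wstar (snd p)" for p :: "((real^'n) \<times> 'a) \<times> 'z"
  define D' where "D' p = (1 / real b) * (\<Sum>i<b. D (fst p, snd p i))" for p :: "((real^'n) \<times> 'a) \<times> (nat \<Rightarrow> 'z)"
  have D_meas [measurable]: "D \<in> borel_measurable ((borel \<Otimes>\<^sub>M A) \<Otimes>\<^sub>M M)"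
    unfolding D_def by measurable
  have D'_meas [measurable]: "D' \<in> borel_measurable ((borel \<Otimes>\<^sub>M A) \<Otimes>\<^sub>M S)"
    unfolding D'_def by measurable
  have D'_eq: "D' p = batch_mean b f (c (fst (fst p))) (snd p) - batch_mean b f wstar (snd p)" for p
    by (simp add: D'_def D_def batch_mean_def sum_subtractf right_diff_distrib diff_divide_distrib)
  define r where "r j = integral\<^sup>L (\<nu> j \<Otimes>\<^sub>M M) D" for j

  have serial_eq: "serial_regret \<phi> (\<alpha> v) (w1, a1) (batch_mean b f) (batch_mean b g) wstar n z
      = (\<Sum>j<n. D' (T' j z, z j))" for n z
  proof -
    have "run \<phi> (\<alpha> v) (w1, a1) (\<lambda>j w. batch_mean b g w (z j)) j = T' j z" for j
      unfolding T'_def h_def by (rule run_cong[OF rule init]) (simp add: c_eq)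
    then show ?thesis
      by (simp add: serial_regret_def serial_predictor_def D'_eq c_eq T'_in)
  qed
  have "stochastic_loss W L F gF v S (batch_mean b f) (batch_mean b g)"
    unfolding v_def by (rule stochastic_loss_batch_mean[OF loss b])
  moreover have "0 \<le> v" by (simp add: v_def)
  ultimately have "expectation_le S.S (serial_regret \<phi> (\<alpha> v) (w1, a1) (batch_mean b f) (batch_mean b g) wstar n)
      (\<psi> v n)" if "1 \<le> n" for n
    using serial[unfolded serial_regret_bound_def, rule_format, of v S "batch_mean b f" "batch_mean b g" n] that
    by simp
  then have serial_le: "expectation_le S.S (\<lambda>z. \<Sum>j<n. D' (T' j z, z j)) (\<psi> v n)" if "1 \<le> n" for n
    using that by (simp only: serial_eq[abs_def])
  \<comment> \<open>The serial bound speaks of partial sums; one round is the difference of two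
    consecutive ones, the empty sum being trivially integrable.\<close>
  have serial_int: "integrable S.S (\<lambda>z. D' (T' j z, z j))" for j
  proof -
    have "integrable S.S (\<lambda>z. \<Sum>j<n. D' (T' j z, z j))" for n
      using serial_le[of n] by (cases n) (auto simp: expectation_le_def)
    from Bochner_Integration.integrable_diff[OF this[of "Suc j"] this[of j]] show ?thesis by simp
  qed
  have TS': "(\<lambda>z. (T' j z, z j)) \<in> S.S \<rightarrow>\<^sub>M (borel \<Otimes>\<^sub>M A) \<Otimes>\<^sub>M S" for j by measurable
  have D'_int: "integrable (\<nu> j \<Otimes>\<^sub>M S) D'"
    and D'_integral: "integral\<^sup>L (\<nu> j \<Otimes>\<^sub>M S) D' = (\<integral>z. D' (T' j z, z j) \<partial>S.S)" for j
    using integrable_distr_eq[OF TS' D'_meas, of j] integral_distr[OF TS' D'_meas, of j] serial_int[of j]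
    by (simp_all only: T'_sample)
  \<comment> \<open>Integrability passes from the batch average to a single input.\<close>
  have D_int: "integrable (\<nu> j \<Otimes>\<^sub>M M) D" for j
  proof -
    obtain n where n: "b = Suc n" using b by (cases b) auto
    from integrable_mult_right[OF D'_int[of j], of "real b"]
    have sum: "integrable (\<nu> j \<Otimes>\<^sub>M S) (\<lambda>(s, x). \<Sum>i<Suc n. D (s, x i))"
      using b by (simp add: D'_def case_prod_beta' n del: of_nat_Suc sum.lessThan_Suc)
    have "integrable (\<nu> j \<Otimes>\<^sub>M M) (\<lambda>(s, z). D (s, z))"
    proof (rule integrable_pair_of_sum[OF \<nu>_prob _ _ sum])
      show "integrable M (\<lambda>z. D (s, z))" for s
        unfolding D_def by (intro Bochner_Integration.integrable_diff) (auto intro: fW c_in wstar)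
    qed measurable
    then show ?thesis by simp
  qed
  have r_nonneg: "0 \<le> r j" for j
  proof -
    interpret \<nu>: prob_space "\<nu> j" by (rule \<nu>_prob)
    interpret \<nu>M: pair_prob_space "\<nu> j" M ..
    \<comment> \<open>Given the state, a fresh input averages the loss to its mean \<open>F\<close>,
      which \<open>wstar\<close> minimises on \<open>W\<close>.\<close>
    have "r j = (\<integral>s. (\<integral>z. D (s, z) \<partial>M) \<partial>\<nu> j)"
      unfolding r_def by (rule \<nu>M.integral_fst'[OF D_int, symmetric])
    also have "\<dots> = (\<integral>s. F (c (fst s)) - F wstar \<partial>\<nu> j)"
      unfolding D_def by (simp add: fW c_in wstar)
    also have "0 \<le> \<dots>" by (intro Bochner_Integration.integral_nonneg) (simp add: F_ge c_in)
    finally show ?thesis .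
  qed
  have "integral\<^sup>L (\<nu> j \<Otimes>\<^sub>M S) D' = r j" for j
    unfolding D'_def r_def using b
    by (simp add: integrable_pair_component[OF \<nu>_prob D_int] integral_pair_component[OF \<nu>_prob D_int])
  then have r_eq: "(\<integral>z. D' (T' j z, z j) \<partial>S.S) = r j" for j
    by (simp only: D'_integral)

  define n where "n = nat \<lceil>real m / real B\<rceil>"
  have B: "B \<ge> 1" using b by (simp add: B_def)
  have "0 < real m / real B" using B m by simp
  then have n1: "1 \<le> n" unfolding n_def by linarith
  have "real m / real B \<le> real n" unfolding n_def by linarith
  then have "real m \<le> real (n * B)" using B by (simp add: divide_le_eq)
  then have mn: "m \<le> n * B" by (simp only: of_nat_le_iff)
  have sum_r: "(\<Sum>j<n. r j) \<le> \<psi> v n"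
    using serial_le[OF n1] unfolding expectation_le_def
    by (simp add: serial_int r_eq)

  have TS: "(\<lambda>z. (T j z, \<lambda>i. z (j * B + i))) \<in> S \<rightarrow>\<^sub>M (borel \<Otimes>\<^sub>M A) \<Otimes>\<^sub>M S" for j by measurable
  have Di: "(\<lambda>p. D (fst p, snd p i)) \<in> borel_measurable ((borel \<Otimes>\<^sub>M A) \<Otimes>\<^sub>M S)" for i by measurable
  \<comment> \<open>Since \<open>i = (i div B) * B + i mod B\<close>, input \<open>i\<close> is
    entry \<open>i mod B\<close> of the tail that is paired with the state
    \<open>T (i div B)\<close>.\<close>
  have term_int: "integrable S (\<lambda>z. D (T (i div B) z, z i))"
    and term_integral: "(\<integral>z. D (T (i div B) z, z i) \<partial>S) = r (i div B)" for i
    using integrable_distr_eq[OF TS Di, of "i div B" "i mod B"]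
      integral_distr[OF TS Di, of "i div B" "i mod B"]
    by (simp_all add: T_sample r_def integrable_pair_component[OF \<nu>_prob D_int]
        integral_pair_component[OF \<nu>_prob D_int])
  have regret_eq: "dmb_regret \<phi> (\<alpha> v) (w1, a1) f g wstar b \<mu> m z
      = (\<Sum>i<m. D (T (i div B) z, z i))" for z
  proof -
    have "run \<phi> (\<alpha> v) (w1, a1) (\<lambda>j w. (1 / real b) *\<^sub>R (\<Sum>i<b. g w (z (j * (b + \<mu>) + i)))) j = T j z" for j
      unfolding T_def h_def batch_mean_def B_def by (rule run_cong[OF rule init]) (simp add: c_eq)
    then show ?thesis
      by (simp add: dmb_regret_def dmb_predictor_def D_def c_eq T_in flip: B_def)
  qed
  have "(\<Sum>i<m. r (i div B)) \<le> real B * (\<Sum>j<n. r j)"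
    by (rule sum_div_le[OF r_nonneg mn])
  also have "\<dots> \<le> real B * \<psi> v n" by (intro mult_left_mono sum_r) simp
  finally have "expectation_le S (dmb_regret \<phi> (\<alpha> v) (w1, a1) f g wstar b \<mu> m) (real B * \<psi> v n)"
    unfolding expectation_le_def regret_eq[abs_def]
    by (simp add: term_int term_integral)
  then show ?thesis
    by (simp add: dmb_expected_regret_le_def v_def n_def B_def)
qed

section \<open>Explicit rates\<close>

lemma dmb_expected_regret_le_mono:
  assumes "dmb_expected_regret_le \<sigma> M f g wstar \<phi> \<alpha> w1 a1 b \<mu> m c" "c \<le> c'"
  shows "dmb_expected_regret_le \<sigma> M f g wstar \<phi> \<alpha> w1 a1 b \<mu> m c'"
  using assms by (auto simp: dmb_expected_regret_le_def expectation_le_def)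

text \<open>Write \<open>B = b + \<mu>\<close> and let \<open>n\<close> be the number of batches.
  Then \<open>n \<le> m / B + 1\<close>, and the square of \<open>B * sqrt (n / b)\<close> is at
  most \<open>m + \<mu> * m / b + B^2 / b\<close>; subadditivity of the square root separates the
  three terms.\<close>

lemma sqrt_rate_le:
  fixes D L \<sigma> :: real and b \<mu> m :: nat
  assumes D: "0 \<le> D" and \<sigma>: "0 \<le> \<sigma>" and b: "1 \<le> b"
  shows "real (b + \<mu>) * (2 * D\<^sup>2 * L
      + 2 * D * sqrt (\<sigma>\<^sup>2 / real b) * sqrt (real (nat \<lceil>real m / real (b + \<mu>)\<rceil>)))
    \<le> 2 * D\<^sup>2 * L * (real b + real \<mu>)
      + 2 * D * \<sigma> * (sqrt (real m) + sqrt (real \<mu> * real m / real b) + (real b + real \<mu>) / sqrt (real b))"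
proof -
  define n where "n = nat \<lceil>real m / real (b + \<mu>)\<rceil>"
  let ?B = "real b + real \<mu>"
  have B: "0 < ?B" using b by simp
  have "real n \<le> real m / ?B + 1" unfolding n_def
    by (simp add: of_nat_nat)
  then have "?B * real n \<le> real m + ?B"
    using B by (simp add: field_simps)
  \<comment> \<open>The factor \<open>?B / real b\<close> turns the left side into the square of
    \<open>?B / sqrt (real b) * sqrt (real n)\<close>.\<close>
  then have "?B * real n * (?B / real b) \<le> (real m + ?B) * (?B / real b)"
    using B by (intro mult_right_mono) auto
  also have "\<dots> = real m + real \<mu> * real m / real b + ?B\<^sup>2 / real b"
    using b by (simp add: field_simps power2_eq_square)
  finally have "sqrt (?B * real n * (?B / real b)) \<le> sqrt (real m + real \<mu> * real m / real b + ?B\<^sup>2 / real b)"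
    by (rule real_sqrt_le_mono)
  also have "\<dots> \<le> sqrt (real m) + sqrt (real \<mu> * real m / real b) + sqrt (?B\<^sup>2 / real b)"
    by (intro order_trans[OF sqrt_add_le_add_sqrt] add_right_mono sqrt_add_le_add_sqrt) auto
  also have "sqrt (?B\<^sup>2 / real b) = ?B / sqrt (real b)"
    using B by (simp add: real_sqrt_divide)
  also have "sqrt (?B * real n * (?B / real b)) = ?B / sqrt (real b) * sqrt (real n)"
    using B by (simp add: real_sqrt_mult real_sqrt_divide)
  finally have "?B / sqrt (real b) * sqrt (real n)
      \<le> sqrt (real m) + sqrt (real \<mu> * real m / real b) + ?B / sqrt (real b)" .
  then have "2 * D * \<sigma> * (?B / sqrt (real b) * sqrt (real n))
      \<le> 2 * D * \<sigma> * (sqrt (real m) + sqrt (real \<mu> * real m / real b) + ?B / sqrt (real b))"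
    using D \<sigma> by (intro mult_left_mono) auto
  moreover have "real (b + \<mu>) * (2 * D\<^sup>2 * L + 2 * D * sqrt (\<sigma>\<^sup>2 / real b) * sqrt (real n))
      = 2 * D\<^sup>2 * L * ?B + 2 * D * \<sigma> * (?B / sqrt (real b) * sqrt (real n))"
    using \<sigma> by (simp add: real_sqrt_divide algebra_simps)
  ultimately show ?thesis unfolding n_def by linarith
qed

lemma powr_div_sqrt_tendsto_0:
  assumes "p < 1/2"
  shows "(\<lambda>m. real m powr p / sqrt (real m)) \<longlonglongrightarrow> 0"
proof -
  have "(\<lambda>m. real m powr (p - 1/2)) \<longlonglongrightarrow> 0"
    using assms by (intro tendsto_neg_powr filterlim_real_sequentially) auto
  then show ?thesis by (simp add: powr_diff powr_half_sqrt)
qed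

text \<open>Keeping the exponents symbolic serves both specialised claims; everything after the
  leading term is grouped to become the remainder.\<close>

lemma dmb_expected_regret_powr:
  fixes W :: "(real^'n) set" and M :: "'z measure"
  assumes setting: "dmb_setting W L \<sigma> F gF M f g wstar A \<phi> \<alpha> w1 a1
      (\<lambda>v m. 2 * D\<^sup>2 * L + 2 * D * sqrt v * sqrt (real m))"
    and D: "0 \<le> D" and b: "1 \<le> b" and m: "1 \<le> m" and b_eq: "real b = real m powr \<rho>"
  shows "dmb_expected_regret_le \<sigma> M f g wstar \<phi> \<alpha> w1 a1 b \<mu> m
    (2 * D * \<sigma> * sqrt (real m)
      + (2 * D\<^sup>2 * L * (real m powr \<rho> + real \<mu>)
      + 2 * D * \<sigma> * (sqrt (real \<mu>) * real m powr ((1 - \<rho>) / 2)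
        + real m powr (\<rho> / 2) + real \<mu> * real m powr (- \<rho> / 2))))"
proof (rule dmb_expected_regret_le_mono[OF dmb_expected_regret_bound[OF setting b m]])
  have \<sigma>: "0 \<le> \<sigma>" using setting by (simp add: dmb_setting_def)
  have m0: "0 < real m" using m by simp
  have sqrt_b: "sqrt (real b) = real m powr (\<rho> / 2)"
    by (simp add: b_eq powr_powr flip: powr_half_sqrt)
  have "sqrt (real \<mu> * real m / real b) = sqrt (real \<mu>) * (sqrt (real m) / sqrt (real b))"
    by (simp add: real_sqrt_mult real_sqrt_divide)
  also have "sqrt (real m) / sqrt (real b) = real m powr ((1 - \<rho>) / 2)"
    unfolding sqrt_b by (simp add: diff_divide_distrib powr_diff powr_half_sqrt)
  finally have 1: "sqrt (real \<mu> * real m / real b) = sqrt (real \<mu>) * real m powr ((1 - \<rho>) / 2)" .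
  have "real b / sqrt (real b) = sqrt (real b)" by (rule real_div_sqrt) simp
  then have 2: "(real b + real \<mu>) / sqrt (real b)
      = real m powr (\<rho> / 2) + real \<mu> * real m powr (- \<rho> / 2)"
    by (simp add: add_divide_distrib sqrt_b powr_minus_divide)
  show "real (b + \<mu>) * (2 * D\<^sup>2 * L + 2 * D * sqrt (\<sigma>\<^sup>2 / real b)
      * sqrt (real (nat \<lceil>real m / real (b + \<mu>)\<rceil>)))
    \<le> 2 * D * \<sigma> * sqrt (real m)
      + (2 * D\<^sup>2 * L * (real m powr \<rho> + real \<mu>)
      + 2 * D * \<sigma> * (sqrt (real \<mu>) * real m powr ((1 - \<rho>) / 2)
        + real m powr (\<rho> / 2) + real \<mu> * real m powr (- \<rho> / 2)))"
    using sqrt_rate_le[OF D \<sigma> b, of \<mu> L m] unfolding 1 2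
    by (simp add: b_eq algebra_simps)
qed

theorem theorem4:
  shows
    "(\<forall>(W :: (real^'n) set) L \<sigma> F gF (M :: 'z measure) f g wstar (A :: 'a measure)
        (\<phi> :: 'a \<Rightarrow> real^'n \<Rightarrow> 'p \<Rightarrow> (real^'n) \<times> 'a) \<alpha> w1 a1 \<psi> k b \<mu> m.
        dmb_setting W L \<sigma> F gF M f g wstar A \<phi> \<alpha> w1 a1 \<psi> \<and>
        admissible_sizes k b \<mu> \<and> 1 \<le> m \<longrightarrow>
        dmb_expected_regret_le \<sigma> M f g wstar \<phi> \<alpha> w1 a1 b \<mu> m
          (real (b + \<mu>) * \<psi> (\<sigma>\<^sup>2 / real b) (nat \<lceil>real m / real (b + \<mu>)\<rceil>)))
   \<and>
     (\<forall>(W :: (real^'n) set) L \<sigma> F gF (M :: 'z measure) f g wstar (A :: 'a measure)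
        (\<phi> :: 'a \<Rightarrow> real^'n \<Rightarrow> 'p \<Rightarrow> (real^'n) \<times> 'a) \<alpha> w1 a1 D k b \<mu> m.
        0 \<le> D \<and>
        dmb_setting W L \<sigma> F gF M f g wstar A \<phi> \<alpha> w1 a1
          (\<lambda>v m. 2 * D\<^sup>2 * L + 2 * D * sqrt v * sqrt (real m)) \<and>
        admissible_sizes k b \<mu> \<and> 1 \<le> m \<and> real b = real m powr (1/3) \<longrightarrow>
        dmb_expected_regret_le \<sigma> M f g wstar \<phi> \<alpha> w1 a1 b \<mu> m
          (2 * D * \<sigma> * sqrt (real m)
           + 2 * D * real m powr (1/3) * (L * D + \<sigma> * sqrt (real \<mu>))
           + 2 * D * \<sigma> * real m powr (1/6)
           + 2 * D * \<sigma> * real \<mu> * real m powr (-1/6)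
           + 2 * real \<mu> * D\<^sup>2 * L))
   \<and>
     (\<forall>D L \<sigma> \<rho> \<mu> k. 0 \<le> D \<and> 0 < \<rho> \<and> \<rho> < 1/2 \<longrightarrow>
        (\<exists>r :: nat \<Rightarrow> real. (\<lambda>m. r m / sqrt (real m)) \<longlonglongrightarrow> 0 \<and>
          (\<forall>(W :: (real^'n) set) F gF (M :: 'z measure) f g wstar (A :: 'a measure)
             (\<phi> :: 'a \<Rightarrow> real^'n \<Rightarrow> 'p \<Rightarrow> (real^'n) \<times> 'a) \<alpha> w1 a1 b m.
             dmb_setting W L \<sigma> F gF M f g wstar A \<phi> \<alpha> w1 a1
               (\<lambda>v m. 2 * D\<^sup>2 * L + 2 * D * sqrt v * sqrt (real m)) \<and>
             admissible_sizes k b \<mu> \<and> 1 \<le> m \<and> real b = real m powr \<rho> \<longrightarrow>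
             dmb_expected_regret_le \<sigma> M f g wstar \<phi> \<alpha> w1 a1 b \<mu> m
               (2 * D * \<sigma> * sqrt (real m) + r m))))"
proof (intro conjI allI impI)
  fix W :: "(real^'n) set" and L \<sigma> F gF and M :: "'z measure" and f g wstar and A :: "'a measure"
    and \<phi> :: "'a \<Rightarrow> real^'n \<Rightarrow> 'p \<Rightarrow> (real^'n) \<times> 'a" and \<alpha> w1 a1 \<psi> and k b \<mu> m :: nat
  assume "dmb_setting W L \<sigma> F gF M f g wstar A \<phi> \<alpha> w1 a1 \<psi> \<and> admissible_sizes k b \<mu> \<and> 1 \<le> m"
  then show "dmb_expected_regret_le \<sigma> M f g wstar \<phi> \<alpha> w1 a1 b \<mu> m
      (real (b + \<mu>) * \<psi> (\<sigma>\<^sup>2 / real b) (nat \<lceil>real m / real (b + \<mu>)\<rceil>))"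
    by (intro dmb_expected_regret_bound) (auto simp: admissible_sizes_def)
next
  fix W :: "(real^'n) set" and L \<sigma> F gF and M :: "'z measure" and f g wstar and A :: "'a measure"
    and \<phi> :: "'a \<Rightarrow> real^'n \<Rightarrow> 'p \<Rightarrow> (real^'n) \<times> 'a" and \<alpha> w1 a1 and D :: real and k b \<mu> m :: nat
  assume H: "0 \<le> D \<and>
      dmb_setting W L \<sigma> F gF M f g wstar A \<phi> \<alpha> w1 a1
        (\<lambda>v m. 2 * D\<^sup>2 * L + 2 * D * sqrt v * sqrt (real m)) \<and>
      admissible_sizes k b \<mu> \<and> 1 \<le> m \<and> real b = real m powr (1/3)"
  \<comment> \<open>For \<open>\<rho> = 1/3\<close> the exponent \<open>(1 - \<rho>) / 2\<close> is
    again \<open>1/3\<close>, so the \<open>sqrt (real \<mu>)\<close> term merges with the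
    \<open>L * D\<close> term.\<close>
  have "dmb_expected_regret_le \<sigma> M f g wstar \<phi> \<alpha> w1 a1 b \<mu> m
    (2 * D * \<sigma> * sqrt (real m)
      + (2 * D\<^sup>2 * L * (real m powr (1/3) + real \<mu>)
      + 2 * D * \<sigma> * (sqrt (real \<mu>) * real m powr ((1 - 1/3) / 2)
        + real m powr (1/3 / 2) + real \<mu> * real m powr (- (1/3) / 2))))"
    using H by (intro dmb_expected_regret_powr[where L=L]) (auto simp: admissible_sizes_def)
  then show "dmb_expected_regret_le \<sigma> M f g wstar \<phi> \<alpha> w1 a1 b \<mu> m
      (2 * D * \<sigma> * sqrt (real m)
       + 2 * D * real m powr (1/3) * (L * D + \<sigma> * sqrt (real \<mu>))
       + 2 * D * \<sigma> * real m powr (1/6)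
       + 2 * D * \<sigma> * real \<mu> * real m powr (-1/6)
       + 2 * real \<mu> * D\<^sup>2 * L)"
    by (rule dmb_expected_regret_le_mono) (simp add: algebra_simps power2_eq_square)
next
  fix D L \<sigma> \<rho> :: real and \<mu> k :: nat
  assume H: "0 \<le> D \<and> 0 < \<rho> \<and> \<rho> < 1/2"
  \<comment> \<open>The remainder is built from \<open>D\<close>, \<open>L\<close>,
    \<open>\<sigma>\<close>, \<open>\<rho>\<close> and \<open>\<mu>\<close> alone, hence is fixed
    before the loss, its distribution and the update rule.\<close>
  define r where "r m = 2 * D\<^sup>2 * L * (real m powr \<rho> + real \<mu>)
      + 2 * D * \<sigma> * (sqrt (real \<mu>) * real m powr ((1 - \<rho>) / 2)
        + real m powr (\<rho> / 2) + real \<mu> * real m powr (- \<rho> / 2))" for m :: nat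
  let ?q = "\<lambda>p m. real m powr p / sqrt (real m)"
  \<comment> \<open>Every exponent lies below \<open>1/2\<close>: \<open>\<rho>\<close> by
    assumption, \<open>(1 - \<rho>) / 2\<close> because \<open>\<rho>\<close> is positive, and
    \<open>\<rho> / 2\<close> and \<open>- \<rho> / 2\<close> a fortiori.\<close>
  have "(\<lambda>m. 2 * D\<^sup>2 * L * (?q \<rho> m + real \<mu> * (1 / sqrt (real m)))
      + 2 * D * \<sigma> * (sqrt (real \<mu>) * ?q ((1 - \<rho>) / 2) m + ?q (\<rho> / 2) m + real \<mu> * ?q (- \<rho> / 2) m))
      \<longlonglongrightarrow> 2 * D\<^sup>2 * L * (0 + real \<mu> * 0) + 2 * D * \<sigma> * (sqrt (real \<mu>) * 0 + 0 + real \<mu> * 0)"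
    using H by (intro tendsto_intros powr_div_sqrt_tendsto_0 tendsto_divide_0[OF tendsto_const]
        filterlim_at_top_imp_at_infinity filterlim_compose[OF sqrt_at_top filterlim_real_sequentially]) auto
  then have "(\<lambda>m. r m / sqrt (real m)) \<longlonglongrightarrow> 0"
    by (simp add: r_def add_divide_distrib distrib_left)
  moreover have "dmb_expected_regret_le \<sigma> M f g wstar \<phi> \<alpha> w1 a1 b \<mu> m
        (2 * D * \<sigma> * sqrt (real m) + r m)"
    if "dmb_setting W L \<sigma> F gF M f g wstar A \<phi> \<alpha> w1 a1
         (\<lambda>v m. 2 * D\<^sup>2 * L + 2 * D * sqrt v * sqrt (real m)) \<and>
       admissible_sizes k b \<mu> \<and> 1 \<le> m \<and> real b = real m powr \<rho>"
    for W :: "(real^'n) set" and F gF and M :: "'z measure" and f g wstar and A :: "'a measure"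
      and \<phi> :: "'a \<Rightarrow> real^'n \<Rightarrow> 'p \<Rightarrow> (real^'n) \<times> 'a" and \<alpha> w1 a1 and b m :: nat
    unfolding r_def using that H
    by (intro dmb_expected_regret_powr) (auto simp: admissible_sizes_def)
  ultimately show "\<exists>r :: nat \<Rightarrow> real. (\<lambda>m. r m / sqrt (real m)) \<longlonglongrightarrow> 0 \<and>
      (\<forall>(W :: (real^'n) set) F gF (M :: 'z measure) f g wstar (A :: 'a measure)
         (\<phi> :: 'a \<Rightarrow> real^'n \<Rightarrow> 'p \<Rightarrow> (real^'n) \<times> 'a) \<alpha> w1 a1 b m.
         dmb_setting W L \<sigma> F gF M f g wstar A \<phi> \<alpha> w1 a1
           (\<lambda>v m. 2 * D\<^sup>2 * L + 2 * D * sqrt v * sqrt (real m)) \<and>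
         admissible_sizes k b \<mu> \<and> 1 \<le> m \<and> real b = real m powr \<rho> \<longrightarrow>
         dmb_expected_regret_le \<sigma> M f g wstar \<phi> \<alpha> w1 a1 b \<mu> m
           (2 * D * \<sigma> * sqrt (real m) + r m))"
    by (intro exI[of _ r]) blast
qed

end
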